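(* Let the system be affected by anomalies only at the input stage, so that $Y_t=h_0(X_t+\delta_t)$ for all $t\in\mathbb{Z}$ (the output anomalies satisfy $\epsilon_t=0$), and let the baseline function $h_0:\mathbb{R}\to\mathbb{R}$ be Lipschitz continuous. Let the inputs $X_t$ be strictly stationary, $\alpha$-mixing, and have finite $p$-th moments $\mathbb{E}(|X_t|^p)<\infty$ for some $p>1$. Then the outputs $Y_t$ are out of $p$-reasonable order with respect to the inputs whenever the following conditions hold: (i) the input anomalies $\delta_t$ are iid and independent of the inputs $X_t$; (ii) $\mathbb{E}\big(|h_0(X_1+\delta_2)-h_0(X_1+\delta_1)|\big)>0$.
   Context: The inputs $(X_t)_{t\in\mathbb{Z}}$ are real-valued random variables with the same continuous marginal cdf, assumed (almost surely) pairwise distinct, so the order statistics of $X_1,\dots,X_n$ satisfy $X_{1:n}<\cdots<X_{n:n}$. The input anomalies $(\delta_t)_{t\in\mathbb{Z}}$ are real-valued random variables; "independent of the inputs" means the sequence $(\delta_t)$ is independent of the sequence $(X_t)$. A strictly stationary sequence $X_t$ is $\alpha$-mixing if $\alpha_X(t):=\sup|\mathbb{P}(A\cap B)-\mathbb{P}(A)\mathbb{P}(B)|\to 0$ when $t\to\infty$, where the supremum is over all $A\in\sigma(X_u,\,u\le 0)$ and $B\in\sigma(X_v,\,v\ge t)$. The concomitants of the outputs with respect to the inputs are $Y_{t,n}=\sum_{s=1}^n Y_s\mathbf{1}\{X_s=X_{t:n}\}$, $t=1,\dots,n$. The outputs are out of $p$-reasonable order with respect to the inputs if $B_{n,p}:=n^{-1/p}\sum_{t=2}^n|Y_{t,n}-Y_{t-1,n}|\to_{\mathbb{P}}\infty$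 when $n\to\infty$, meaning $\mathbb{P}(B_{n,p}\le\lambda)\to 0$ for every $\lambda<\infty$. *)

theory Defs
  imports "HOL-Probability.Probability"
begin

text \<open>Processes are families \<open>X :: int \<Rightarrow> 'a \<Rightarrow> real\<close> on a measure space \<open>M\<close>, indexed by the
  integers.\<close>

definition strictly_stationary :: "'a measure \<Rightarrow> (int \<Rightarrow> 'a \<Rightarrow> real) \<Rightarrow> bool" where
  "strictly_stationary M X \<longleftrightarrow>
     (\<forall>J k. finite J \<longrightarrow>
        distr M (PiM J (\<lambda>_. borel)) (\<lambda>\<omega>. \<lambda>t\<in>J. X (t + k) \<omega>) =
        distr M (PiM J (\<lambda>_. borel)) (\<lambda>\<omega>. \<lambda>t\<in>J. X t \<omega>))"

text \<open>The events of the sigma-algebra generated by \<open>X u\<close>, \<open>u \<in> I\<close>.\<close>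

definition generated_events :: "'a measure \<Rightarrow> (int \<Rightarrow> 'a \<Rightarrow> real) \<Rightarrow> int set \<Rightarrow> 'a set set" where
  "generated_events M X I =
     sigma_sets (space M) (\<Union>u\<in>I. {X u -` S \<inter> space M | S. S \<in> sets borel})"

definition alpha_coeff :: "'a measure \<Rightarrow> (int \<Rightarrow> 'a \<Rightarrow> real) \<Rightarrow> nat \<Rightarrow> real" where
  "alpha_coeff M X t =
     (SUP (A, B) \<in> generated_events M X {..0} \<times> generated_events M X {int t..}.
        \<bar>measure M (A \<inter> B) - measure M A * measure M B\<bar>)"

text \<open>Meant for strictly stationary \<open>X\<close>: the past is only taken at time \<open>0\<close>.\<close>

definition alpha_mixing :: "'a measure \<Rightarrow> (int \<Rightarrow> 'a \<Rightarrow> real) \<Rightarrow> bool" where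
  "alpha_mixing M X \<longleftrightarrow> alpha_coeff M X \<longlonglongrightarrow> 0"

text \<open>\<open>order_stat X n t\<close> is the \<open>t\<close>-th smallest of \<open>X 1, \<dots>, X n\<close>, meant for \<open>1 \<le> t \<le> n\<close>
  (list positions start at \<open>0\<close>).\<close>

definition order_stat :: "(int \<Rightarrow> 'a \<Rightarrow> real) \<Rightarrow> nat \<Rightarrow> nat \<Rightarrow> 'a \<Rightarrow> real" where
  "order_stat X n t \<omega> = sort (map (\<lambda>s. X s \<omega>) [1..int n]) ! (t - 1)"

definition concomitant ::
    "(int \<Rightarrow> 'a \<Rightarrow> real) \<Rightarrow> (int \<Rightarrow> 'a \<Rightarrow> real) \<Rightarrow> nat \<Rightarrow> nat \<Rightarrow> 'a \<Rightarrow> real" where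
  "concomitant X Y n t \<omega> = (\<Sum>s=1..int n. Y s \<omega> * of_bool (X s \<omega> = order_stat X n t \<omega>))"

definition B_stat ::
    "(int \<Rightarrow> 'a \<Rightarrow> real) \<Rightarrow> (int \<Rightarrow> 'a \<Rightarrow> real) \<Rightarrow> real \<Rightarrow> nat \<Rightarrow> 'a \<Rightarrow> real" where
  "B_stat X Y p n \<omega> =
     real n powr (- 1 / p) *
     (\<Sum>t=2..n. \<bar>concomitant X Y n t \<omega> - concomitant X Y n (t - 1) \<omega>\<bar>)"

definition out_of_reasonable_order ::
    "'a measure \<Rightarrow> (int \<Rightarrow> 'a \<Rightarrow> real) \<Rightarrow> (int \<Rightarrow> 'a \<Rightarrow> real) \<Rightarrow> real \<Rightarrow> bool" where
  "out_of_reasonable_order M X Y p \<longleftrightarrow>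
     (\<forall>l::real. (\<lambda>n. measure M {\<omega> \<in> space M. B_stat X Y p n \<omega> \<le> l}) \<longlonglongrightarrow> 0)"

end

theory Submission
  imports Defs "HOL-Real_Asymp.Real_Asymp"
begin

text \<open>Condition (ii) and Fubini provide a point \<open>x\<^sub>0\<close> in the support of \<open>X\<^sub>1\<close> such that the iid variables
  \<open>Z\<^sub>s = h\<^sub>0 (x\<^sub>0 + \<delta>\<^sub>s)\<close> are not degenerate. Dropping all inputs outside a small ball around \<open>x\<^sub>0\<close> can only
  decrease the variation of the concomitants, and on the remaining indices \<open>Y\<^sub>s\<close> differs from \<open>Z\<^sub>s\<close> by at
  most the Lipschitz constant times the radius. The sorted list of the remaining indices depends on
  the inputs only, hence is independent of \<open>Z\<close>, and by mixing its length is of order \<open>n\<close> with probability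
  tending to \<open>1\<close>. An exponential Markov bound for the independent increments of \<open>Z\<close> over disjoint consecutive
  pairs then shows that the variation is at least of order \<open>n\<close>, which beats \<open>n\<^bsup>1/p\<^esup>\<close> as \<open>p > 1\<close>.\<close>

section \<open>Variation of a function along a list\<close>

fun list_var :: "('b \<Rightarrow> real) \<Rightarrow> 'b list \<Rightarrow> real" where
  "list_var f (a # b # l) = \<bar>f b - f a\<bar> + list_var f (b # l)"
| "list_var f l = 0"

text \<open>Only disjoint pairs contribute, so for independent \<open>f s\<close> the summands are independent.\<close>

fun pair_var :: "('b \<Rightarrow> real) \<Rightarrow> 'b list \<Rightarrow> real" where
  "pair_var f (a # b # l) = \<bar>f b - f a\<bar> + pair_var f l"
| "pair_var f l = 0"

lemma pair_var_nonneg: "0 \<le> pair_var f l"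
  by (induction f l rule: pair_var.induct) auto

lemma list_var_Cons_ge: "list_var f l \<le> list_var f (a # l)"
  by (cases l) auto

lemma list_var_Cons_Cons_ge: "list_var f (a # l) \<le> list_var f (a # b # l)"
  by (cases l) auto

text \<open>By the triangle inequality, deleting an inner entry replaces two consecutive jumps by
  one that is no larger than their sum; deleting an end entry just loses a jump.\<close>

lemma list_var_filter_le: "list_var f (filter P l) \<le> list_var f l"
proof -
  \<comment> \<open>Keeping a first entry \<open>a\<close> in front, for all \<open>a\<close>, makes
    the induction work: a kept \<open>b\<close> becomes the new first entry, and a dropped
    \<open>b\<close> is put back behind \<open>a\<close> by the triangle inequality.\<close>
  have *: "list_var f (a # filter P l) \<le> list_var f (a # l)" for a l
  proof (induction l arbitrary: a)
    case (Cons b l)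
    show ?case
      using Cons[of b] Cons[of a] list_var_Cons_Cons_ge[of f a l b] by (cases "P b") auto
  qed simp
  show ?thesis
  proof (induction l)
    case (Cons b l)
    then show ?case using *[of b l] list_var_Cons_ge[of f l b] by auto
  qed simp
qed

lemma pair_var_le_list_var: "pair_var f l \<le> list_var f l"
proof (induction f l rule: pair_var.induct)
  case (1 f a b l)
  then show ?case using list_var_Cons_ge[of f l b] by simp
qed auto

text \<open>Each increment moves by at most \<open>2 * e\<close>, and only
  \<open>length l div 2\<close> disjoint pairs occur; an unpaired last entry contributes
  nothing.\<close>

lemma pair_var_perturb:
  assumes "\<And>s. s \<in> set l \<Longrightarrow> \<bar>f s - g s\<bar> \<le> e"
  shows "pair_var g l - 2 * e * real (length l div 2) \<le> pair_var f l"
  using assms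
proof (induction f l rule: pair_var.induct)
  case (1 f a b l)
  have "\<bar>f a - g a\<bar> \<le> e" "\<bar>f b - g b\<bar> \<le> e" using 1 by auto
  moreover have "pair_var g l - 2 * e * real (length l div 2) \<le> pair_var f l"
    using 1 by auto
  ultimately show ?case by (simp add: algebra_simps)
qed auto

text \<open>Range and offsets are those of \<open>B_stat\<close>: ranks start at 1 but list
  positions at 0, so ranks \<open>t\<close> and \<open>t - 1\<close> sit at positions
  \<open>t - 1\<close> and \<open>t - 2\<close>.\<close>

lemma list_var_nth: "list_var f l = (\<Sum>t=2..length l. \<bar>f (l ! (t - 1)) - f (l ! (t - 2))\<bar>)"
proof (induction f l rule: list_var.induct)
  case (1 f a b l)
  have "(\<Sum>t=2..length (a # b # l). \<bar>f ((a # b # l) ! (t - 1)) - f ((a # b # l) ! (t - 2))\<bar>)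
    = \<bar>f b - f a\<bar> + (\<Sum>t=3..Suc (length (b # l)). \<bar>f ((a # b # l) ! (t - 1)) - f ((a # b # l) ! (t - 2))\<bar>)"
    by (subst sum.atLeast_Suc_atMost) (auto simp: numeral_eq_Suc)
  also have "(\<Sum>t=3..Suc (length (b # l)). \<bar>f ((a # b # l) ! (t - 1)) - f ((a # b # l) ! (t - 2))\<bar>)
    = (\<Sum>t=2..length (b # l). \<bar>f ((a # b # l) ! t) - f ((a # b # l) ! (t - 1))\<bar>)"
    using sum.shift_bounds_cl_Suc_ivl[of "\<lambda>t. \<bar>f ((a # b # l) ! (t - 1)) - f ((a # b # l) ! (t - 2))\<bar>" 2 "length (b # l)"]
    by (simp add: numeral_eq_Suc)
  also have "\<dots> = (\<Sum>t=2..length (b # l). \<bar>f ((b # l) ! (t - 1)) - f ((b # l) ! (t - 2))\<bar>)"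
    by (intro sum.cong refl) (auto simp: nth_Cons' numeral_eq_Suc)
  finally show ?case using 1 by simp
qed auto

section \<open>Concomitants as values along the sorted index list\<close>

lemma order_stat_eq_nth_sort_key:
  assumes "1 \<le> t" "t \<le> n"
  shows "order_stat X n t \<omega> = X (sort_key (\<lambda>s. X s \<omega>) [1..int n] ! (t - 1)) \<omega>"
proof -
  have "sort (map (\<lambda>s. X s \<omega>) [1..int n]) = map (\<lambda>s. X s \<omega>) (sort_key (\<lambda>s. X s \<omega>) [1..int n])"
    by (rule properties_for_sort) auto
  then show ?thesis using assms by (simp add: order_stat_def)
qed

text \<open>In the absence of ties exactly one indicator in the defining sum is nonzero, namely that
  of the index holding rank \<open>t\<close>.\<close>

lemma concomitant_eq_nth_sort_key:
  assumes "inj_on (\<lambda>s. X s \<omega>) {1..int n}" "1 \<le> t" "t \<le> n"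
  shows "concomitant X Y n t \<omega> = Y (sort_key (\<lambda>s. X s \<omega>) [1..int n] ! (t - 1)) \<omega>"
proof -
  define u where "u = sort_key (\<lambda>s. X s \<omega>) [1..int n] ! (t - 1)"
  have "u \<in> set (sort_key (\<lambda>s. X s \<omega>) [1..int n])"
    unfolding u_def using assms by (intro nth_mem) auto
  then have u: "u \<in> {1..int n}" by simp
  have "concomitant X Y n t \<omega> = (\<Sum>s=1..int n. Y s \<omega> * of_bool (X s \<omega> = X u \<omega>))"
    unfolding concomitant_def u_def using assms by (simp add: order_stat_eq_nth_sort_key)
  also have "\<dots> = (\<Sum>s=1..int n. if s = u then Y s \<omega> else 0)"
    using assms(1) u by (intro sum.cong refl) (auto simp: inj_on_def)
  finally show ?thesis using u by (simp add: u_def)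
qed

lemma B_stat_eq_list_var:
  assumes "inj_on (\<lambda>s. X s \<omega>) {1..int n}"
  shows "B_stat X Y p n \<omega> =
    real n powr (- 1 / p) * list_var (\<lambda>s. Y s \<omega>) (sort_key (\<lambda>s. X s \<omega>) [1..int n])"
  unfolding B_stat_def list_var_nth
  by (intro arg_cong[where f="(*) _"] sum.cong)
     (use assms in \<open>auto simp: concomitant_eq_nth_sort_key diff_diff_left eval_nat_numeral\<close>)

section \<open>Measurability of random lists\<close>

text \<open>Lists over a countable type form a countable type, so random lists can be treated as
  discrete variables; this later makes the list of retained indices an event-valued function of the
  inputs.\<close>

lemma measurable_insort_key:
  fixes f :: "'b :: countable \<Rightarrow> 'a \<Rightarrow> real"
  assumes "\<And>s. f s \<in> borel_measurable M"
  shows "(\<lambda>x. insort_key (\<lambda>s. f s x) a l) \<in> M \<rightarrow>\<^sub>M count_space UNIV"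
proof (induction l)
  case (Cons b l)
  note [measurable] = assms Cons measurable_compose[OF Cons measurable_count_space]
  have "(\<lambda>x. if f a x \<le> f b x then a # b # l else b # insort_key (\<lambda>s. f s x) a l) \<in> M \<rightarrow>\<^sub>M count_space UNIV"
    by measurable
  then show ?case by simp
qed simp

lemma measurable_sort_key:
  fixes f :: "'b :: countable \<Rightarrow> 'a \<Rightarrow> real"
  assumes "\<And>s. f s \<in> borel_measurable M"
  shows "(\<lambda>x. sort_key (\<lambda>s. f s x) l) \<in> M \<rightarrow>\<^sub>M count_space UNIV"
proof (induction l)
  case (Cons a l)
  show ?case
    using measurable_compose_countable[OF measurable_insort_key[OF assms] Cons] by simp
qed simp

lemma measurable_filter:
  fixes P :: "'b :: countable \<Rightarrow> 'a \<Rightarrow> bool"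
  assumes "\<And>s. Measurable.pred M (P s)" and L: "L \<in> M \<rightarrow>\<^sub>M count_space UNIV"
  shows "(\<lambda>x. filter (\<lambda>s. P s x) (L x)) \<in> M \<rightarrow>\<^sub>M count_space UNIV"
proof (rule measurable_compose_countable[OF _ L])
  fix l
  show "(\<lambda>x. filter (\<lambda>s. P s x) l) \<in> M \<rightarrow>\<^sub>M count_space UNIV"
  proof (induction l)
    case (Cons b l)
    note [measurable] = assms(1) Cons
    have "(\<lambda>x. if P b x then b # filter (\<lambda>s. P s x) l else filter (\<lambda>s. P s x) l) \<in> M \<rightarrow>\<^sub>M count_space UNIV"
      by measurable
    then show ?case by simp
  qed simp
qed

lemma borel_measurable_pair_var:
  fixes F :: "'b \<Rightarrow> 'c \<Rightarrow> real"
  assumes "\<And>s. s \<in> set l \<Longrightarrow> F s \<in> borel_measurable N"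
  shows "(\<lambda>x. pair_var (\<lambda>s. F s x) l) \<in> borel_measurable N"
  using assms
\<comment> \<open>The function argument of the rule never changes along the recursion, so a dummy
  instance yields plain induction on \<open>l\<close>, two entries at a time.\<close>
proof (induction "\<lambda>s::'b. 0::real" l rule: pair_var.induct)
  case (1 c d l)
  have [measurable]: "F c \<in> borel_measurable N" "F d \<in> borel_measurable N"
    "(\<lambda>x. pair_var (\<lambda>s. F s x) l) \<in> borel_measurable N"
    using 1 by auto
  show ?case by simp
qed auto

section \<open>Deviation bounds from independence\<close>

text \<open>As \<open>l\<close> is distinct, its pairs use disjoint coordinates, so the exponential
  factors are independent; each has the law of the factor built from \<open>Z i\<close> and
  \<open>Z j\<close>.\<close>

lemma (in prob_space) expectation_exp_pair_var:
  fixes Z :: "'i \<Rightarrow> 'a \<Rightarrow> real"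
  assumes indep: "indep_vars (\<lambda>_. borel) Z UNIV"
    and distr: "\<And>s t. distr M borel (Z s) = distr M borel (Z t)"
    and "distinct l" and "i \<noteq> j"
  shows "expectation (\<lambda>\<omega>. exp (- pair_var (\<lambda>s. Z s \<omega>) l)) =
    expectation (\<lambda>\<omega>. exp (- \<bar>Z j \<omega> - Z i \<omega>\<bar>)) ^ (length l div 2)"
  using assms(3)
proof (induction "\<lambda>s::'i. 0::real" l rule: pair_var.induct)
  case (1 a b l)
  have Z: "Z s \<in> borel_measurable M" for s
    using indep by (auto simp: indep_vars_def)
  note [measurable] = Z
  let ?f = "\<lambda>x. exp (- \<bar>x b - x a\<bar> :: real)" and ?g = "\<lambda>x. exp (- pair_var x l)"
  have pair: "indep_var borel (Z s) borel (Z t)" if "s \<noteq> t" for s t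
  proof -
    have "indep_var (PiM {s} (\<lambda>_. borel)) (\<lambda>\<omega>. restrict (\<lambda>i. Z i \<omega>) {s})
        (PiM {t} (\<lambda>_. borel)) (\<lambda>\<omega>. restrict (\<lambda>i. Z i \<omega>) {t})"
      using that by (intro indep_var_restrict[OF indep]) auto
    then have "indep_var borel ((\<lambda>x. x s) \<circ> (\<lambda>\<omega>. restrict (\<lambda>i. Z i \<omega>) {s}))
        borel ((\<lambda>x. x t) \<circ> (\<lambda>\<omega>. restrict (\<lambda>i. Z i \<omega>) {t}))"
      by (rule indep_var_compose) simp_all
    then show ?thesis by (simp add: comp_def)
  qed
  \<comment> \<open>Independence and equal marginals give \<open>(Z a, Z b)\<close> and
    \<open>(Z i, Z j)\<close> the same joint law.\<close>
  have same: "expectation (\<lambda>\<omega>. exp (- \<bar>Z b \<omega> - Z a \<omega>\<bar>)) = expectation (\<lambda>\<omega>. exp (- \<bar>Z j \<omega> - Z i \<omega>\<bar>))"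
  proof -
    have "distr M (borel \<Otimes>\<^sub>M borel) (\<lambda>\<omega>. (Z a \<omega>, Z b \<omega>)) = distr M (borel \<Otimes>\<^sub>M borel) (\<lambda>\<omega>. (Z i \<omega>, Z j \<omega>))"
      using pair[of a b] pair[of i j] 1(2) \<open>i \<noteq> j\<close> distr[of a i] distr[of b j]
      by (simp add: indep_var_distribution_eq)
    then have "integral\<^sup>L (distr M (borel \<Otimes>\<^sub>M borel) (\<lambda>\<omega>. (Z a \<omega>, Z b \<omega>))) (\<lambda>(x, y). exp (- \<bar>y - x\<bar>)) =
      integral\<^sup>L (distr M (borel \<Otimes>\<^sub>M borel) (\<lambda>\<omega>. (Z i \<omega>, Z j \<omega>))) (\<lambda>(x, y). exp (- \<bar>y - x\<bar>))"
      by simp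
    then show ?thesis by (simp add: integral_distr)
  qed
  have "indep_var (PiM {a, b} (\<lambda>_. borel)) (\<lambda>\<omega>. restrict (\<lambda>i. Z i \<omega>) {a, b})
      (PiM (set l) (\<lambda>_. borel)) (\<lambda>\<omega>. restrict (\<lambda>i. Z i \<omega>) (set l))"
    using 1(2) by (intro indep_var_restrict[OF indep]) auto
  moreover have "?f \<in> PiM {a, b} (\<lambda>_. borel) \<rightarrow>\<^sub>M borel" by simp
  moreover have "?g \<in> PiM (set l) (\<lambda>_. borel) \<rightarrow>\<^sub>M borel"
    using borel_measurable_pair_var[of l "\<lambda>s x. x s" "PiM (set l) (\<lambda>_. borel)"] by simp
  ultimately have ind: "indep_var borel (?f \<circ> (\<lambda>\<omega>. restrict (\<lambda>i. Z i \<omega>) {a, b}))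
      borel (?g \<circ> (\<lambda>\<omega>. restrict (\<lambda>i. Z i \<omega>) (set l)))"
    by (rule indep_var_compose)
  have f: "?f \<circ> (\<lambda>\<omega>. restrict (\<lambda>i. Z i \<omega>) {a, b}) = (\<lambda>\<omega>. ?f (\<lambda>i. Z i \<omega>))"
    by auto
  \<comment> \<open>The restricted path is arbitrary outside \<open>S\<close>, but only the entries
    of \<open>l'\<close> are ever read.\<close>
  have "pair_var (restrict x S) l' = pair_var x l'" if "set l' \<subseteq> S" for x :: "'i \<Rightarrow> real" and S l'
    using that by (induction x l' rule: pair_var.induct) auto
  then have g: "?g \<circ> (\<lambda>\<omega>. restrict (\<lambda>i. Z i \<omega>) (set l)) = (\<lambda>\<omega>. ?g (\<lambda>i. Z i \<omega>))"
    by auto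
  have "expectation (\<lambda>\<omega>. exp (- pair_var (\<lambda>s. Z s \<omega>) (a # b # l))) =
    expectation (\<lambda>\<omega>. ?f (\<lambda>i. Z i \<omega>) * ?g (\<lambda>i. Z i \<omega>))"
    by (simp add: exp_add[symmetric])
  also have "\<dots> = expectation (\<lambda>\<omega>. ?f (\<lambda>i. Z i \<omega>)) * expectation (\<lambda>\<omega>. ?g (\<lambda>i. Z i \<omega>))"
  proof (rule indep_var_lebesgue_integral)
    show "indep_var borel (\<lambda>\<omega>. ?f (\<lambda>i. Z i \<omega>)) borel (\<lambda>\<omega>. ?g (\<lambda>i. Z i \<omega>))"
      using ind unfolding f g .
    show "integrable M (\<lambda>\<omega>. ?f (\<lambda>i. Z i \<omega>))"
      by (rule integrable_const_bound[where B=1]) auto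
    show "integrable M (\<lambda>\<omega>. ?g (\<lambda>i. Z i \<omega>))"
      using borel_measurable_pair_var[of l Z M] Z by (intro integrable_const_bound[where B=1]) (auto simp: pair_var_nonneg)
  qed
  finally show ?case using 1 same by simp
qed (auto simp: prob_space)

text \<open>Chernoff bound: with m pairs the exponential moment is
  \<open>exp (- 2 * \<kappa> * m)\<close>, and Markov at level \<open>exp (- \<kappa> * m)\<close>
  spends half of the exponent.\<close>

lemma (in prob_space) prob_pair_var_le:
  fixes Z :: "'i \<Rightarrow> 'a \<Rightarrow> real"
  assumes indep: "indep_vars (\<lambda>_. borel) Z UNIV"
    and distr: "\<And>s t. distr M borel (Z s) = distr M borel (Z t)"
    and "distinct l" and "i \<noteq> j"
    and k: "expectation (\<lambda>\<omega>. exp (- \<bar>Z j \<omega> - Z i \<omega>\<bar>)) = exp (- 2 * \<kappa>)"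
  shows "prob {\<omega> \<in> space M. pair_var (\<lambda>s. Z s \<omega>) l \<le> \<kappa> * real (length l div 2)}
    \<le> exp (- \<kappa> * real (length l div 2))"
proof -
  define m where "m = length l div 2"
  have Z: "Z s \<in> borel_measurable M" for s
    using indep by (auto simp: indep_vars_def)
  have [measurable]: "(\<lambda>x. pair_var (\<lambda>s. Z s x) l) \<in> borel_measurable M"
    by (rule borel_measurable_pair_var) (rule Z)
  have "prob {\<omega> \<in> space M. exp (- pair_var (\<lambda>s. Z s \<omega>) l) \<ge> exp (- \<kappa> * m)} \<le>
    expectation (\<lambda>\<omega>. exp (- pair_var (\<lambda>s. Z s \<omega>) l)) / exp (- \<kappa> * m)"
    by (rule integral_Markov_inequality_measure[where A="{}"])
       (auto intro!: integrable_const_bound[where B=1] simp: pair_var_nonneg)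
  also have "\<dots> = exp (- \<kappa> * m)"
    unfolding expectation_exp_pair_var[OF assms(1-4)] k m_def[symmetric]
    by (simp add: exp_of_nat_mult[symmetric] exp_diff[symmetric] algebra_simps)
  finally show ?thesis by (simp add: m_def)
qed

text \<open>Lets the exceptional set \<open>G i\<close> depend on which class \<open>A i\<close>
  contains \<open>U\<close>. Independence factors each term, and the disjoint events for
  \<open>U\<close> have total probability at most 1, so the bound \<open>c\<close> does not pick up
  the cardinality of \<open>I\<close>.\<close>

lemma (in prob_space) prob_Union_le_of_indep:
  assumes indep: "indep_var S D T U" and "finite I"
    and A: "\<And>i. i \<in> I \<Longrightarrow> A i \<in> sets T" "disjoint_family_on A I"
    and G: "\<And>i. i \<in> I \<Longrightarrow> G i \<in> sets S"
    and le: "\<And>i. i \<in> I \<Longrightarrow> prob (D -` G i \<inter> space M) \<le> c" and "0 \<le> c"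
  shows "prob (\<Union>i\<in>I. (D -` G i \<inter> space M) \<inter> (U -` A i \<inter> space M)) \<le> c"
proof -
  have [measurable]: "D \<in> M \<rightarrow>\<^sub>M S" "U \<in> M \<rightarrow>\<^sub>M T"
    using indep by (blast dest: indep_var_rv1 indep_var_rv2)+
  have meas: "D -` G i \<inter> space M \<in> events" "U -` A i \<inter> space M \<in> events" if "i \<in> I" for i
    using A G that by (auto intro: measurable_sets)
  have "prob (\<Union>i\<in>I. (D -` G i \<inter> space M) \<inter> (U -` A i \<inter> space M))
    \<le> (\<Sum>i\<in>I. prob ((D -` G i \<inter> space M) \<inter> (U -` A i \<inter> space M)))"
    using meas \<open>finite I\<close> by (intro finite_measure_subadditive_finite) auto
  also have "\<dots> = (\<Sum>i\<in>I. prob (D -` G i \<inter> space M) * prob (U -` A i \<inter> space M))"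
  proof (rule sum.cong)
    fix i assume "i \<in> I"
    have "(D -` G i \<inter> space M) \<inter> (U -` A i \<inter> space M) = (\<lambda>x. (D x, U x)) -` (G i \<times> A i) \<inter> space M"
      by auto
    then show "prob ((D -` G i \<inter> space M) \<inter> (U -` A i \<inter> space M)) = prob (D -` G i \<inter> space M) * prob (U -` A i \<inter> space M)"
      using indep_varD[OF indep G[OF \<open>i \<in> I\<close>] A(1)[OF \<open>i \<in> I\<close>]] by simp
  qed simp
  also have "\<dots> \<le> (\<Sum>i\<in>I. c * prob (U -` A i \<inter> space M))"
    by (intro sum_mono mult_right_mono le) auto
  also have "\<dots> = c * prob (\<Union>i\<in>I. U -` A i \<inter> space M)"
    using meas \<open>finite I\<close> A(2)
    by (subst finite_measure_finite_Union) (auto simp: sum_distrib_left disjoint_family_on_def, blast)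
  also have "\<dots> \<le> c" using \<open>0 \<le> c\<close> by (simp add: mult_left_le)
  finally show ?thesis .
qed

section \<open>Visits of a mixing stationary sequence to a set\<close>

lemma cesaro_mean_tendsto_0:
  fixes a :: "nat \<Rightarrow> real"
  assumes "a \<longlonglongrightarrow> 0"
  shows "(\<lambda>n. (\<Sum>k<n. a k) / real n) \<longlonglongrightarrow> 0"
proof (rule LIMSEQ_I)
  fix e :: real assume "e > 0"
  obtain K where K: "\<And>k. k \<ge> K \<Longrightarrow> \<bar>a k\<bar> < e / 2"
    using LIMSEQ_D[OF assms, of "e / 2"] \<open>e > 0\<close> by auto
  define C where "C = (\<Sum>k<K. \<bar>a k\<bar>)"
  obtain N where N: "real N > 2 * C / e" using reals_Archimedean2 by blast
  show "\<exists>N. \<forall>n\<ge>N. norm ((\<Sum>k<n. a k) / real n - 0) < e"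
  proof (intro exI allI impI)
    fix n assume n: "n \<ge> max (Suc N) K"
    have "\<bar>\<Sum>k<n. a k\<bar> \<le> (\<Sum>k<n. \<bar>a k\<bar>)" by (rule sum_abs)
    also have "\<dots> = C + (\<Sum>k=K..<n. \<bar>a k\<bar>)"
      unfolding C_def using n by (simp add: lessThan_atLeast0 sum.atLeastLessThan_concat)
    also have "(\<Sum>k=K..<n. \<bar>a k\<bar>) \<le> (\<Sum>k=K..<n. e / 2)"
      using K by (intro sum_mono less_imp_le) auto
    also have "\<dots> \<le> n * (e / 2)" using n \<open>e > 0\<close> by (simp add: mult_right_mono)
    also have "C < n * (e / 2)"
    proof -
      have "real N < real n" using n by simp
      then have "2 * C / e < real n" using N by linarith
      then show ?thesis using \<open>e > 0\<close> by (simp add: field_simps)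
    qed
    finally show "norm ((\<Sum>k<n. a k) / real n - 0) < e"
      using n by (simp add: field_simps)
  qed
qed

lemma strictly_stationaryD:
  assumes "strictly_stationary M X" and [measurable]: "\<And>t. X t \<in> borel_measurable M"
    and "finite J" and "B \<in> sets (PiM J (\<lambda>_. borel))"
  shows "measure M {\<omega> \<in> space M. (\<lambda>t\<in>J. X (t + k) \<omega>) \<in> B} =
    measure M {\<omega> \<in> space M. (\<lambda>t\<in>J. X t \<omega>) \<in> B}"
proof -
  have "measure (distr M (PiM J (\<lambda>_. borel)) (\<lambda>\<omega>. \<lambda>t\<in>J. X (t + k) \<omega>)) B =
    measure (distr M (PiM J (\<lambda>_. borel)) (\<lambda>\<omega>. \<lambda>t\<in>J. X t \<omega>)) B"
    using assms(1,3) by (simp add: strictly_stationary_def)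
  then show ?thesis
    using assms(4) by (simp add: measure_distr measurable_restrict vimage_def Int_def conj_commute)
qed

lemma strictly_stationary_marginal:
  assumes "strictly_stationary M X" and X: "\<And>t. X t \<in> borel_measurable M"
    and [measurable]: "S \<in> sets borel"
  shows "measure M {\<omega> \<in> space M. X s \<omega> \<in> S} = measure M {\<omega> \<in> space M. X 0 \<omega> \<in> S}"
proof -
  have "{x \<in> space (PiM {0} (\<lambda>_::int. borel)). x 0 \<in> S} \<in> sets (PiM {0} (\<lambda>_. borel))"
    by measurable
  from strictly_stationaryD[OF assms(1) X _ this, of s] show ?thesis
    by (simp add: space_PiM)
qed

lemma (in prob_space) generated_events_subset:
  assumes "\<And>t. X t \<in> borel_measurable M"
  shows "generated_events M X I \<subseteq> events"
  unfolding generated_events_def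
  by (rule sets.sigma_sets_subset) (use assms in \<open>auto intro: measurable_sets\<close>)

lemma (in prob_space) alpha_coeff_ge:
  assumes "\<And>t. X t \<in> borel_measurable M"
    and "A \<in> generated_events M X {..0}" "B \<in> generated_events M X {int t..}"
  shows "\<bar>prob (A \<inter> B) - prob A * prob B\<bar> \<le> alpha_coeff M X t"
proof -
  \<comment> \<open>A real supremum dominates its members only for a family bounded above; 1 is such
    a bound.\<close>
  have le1: "\<bar>prob (A \<inter> B) - prob A * prob B\<bar> \<le> 1" for A B
  proof -
    have "0 \<le> prob A * prob B" "prob A * prob B \<le> 1" by (auto simp: mult_le_one)
    moreover have "0 \<le> prob (A \<inter> B)" "prob (A \<inter> B) \<le> 1" by auto
    ultimately show ?thesis by linarith
  qed
  have "(case (A, B) of (A, B) \<Rightarrow> \<bar>prob (A \<inter> B) - prob A * prob B\<bar>) \<le> alpha_coeff M X t"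
    unfolding alpha_coeff_def
    by (rule cSUP_upper) (use assms le1 in \<open>auto intro!: bdd_aboveI[where M=1]\<close>)
  then show ?thesis by simp
qed

text \<open>Chebyshev: the covariances of the visit indicators are bounded by mixing coefficients,
  so the variance of the count is at most \<open>2 * n\<close> times their partial sum. This is of
  smaller order than the square of the mean \<open>n * q\<close>, because the Cesaro means of the
  coefficients vanish.\<close>

lemma (in prob_space) mixing_hits_lower_tail:
  assumes X: "\<And>t. X t \<in> borel_measurable M"
    and stat: "strictly_stationary M X" and mix: "alpha_mixing M X"
    and S: "S \<in> sets borel" and q: "q = prob {\<omega> \<in> space M. X 0 \<omega> \<in> S}" "0 < q"
  shows "(\<lambda>n. prob {\<omega> \<in> space M. real (card {s \<in> {1..int n}. X s \<omega> \<in> S}) \<le> real n * q / 2}) \<longlonglongrightarrow> 0"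
proof -
  note [measurable] = X S
  define \<alpha> where "\<alpha> = alpha_coeff M X"
  define A where "A s = {\<omega> \<in> space M. X s \<omega> \<in> S}" for s
  have A[measurable]: "A s \<in> events" for s unfolding A_def by measurable
  have pA: "prob (A s) = q" for s
    using strictly_stationary_marginal[OF stat X S] by (simp add: q A_def)
  \<comment> \<open>\<open>alpha_coeff\<close> places the past at time 0, so stationarity must first
    move the pair of times there.\<close>
  have shift: "prob (A s \<inter> A t) = prob (A 0 \<inter> A (t - s))" for s t
  proof -
    define d J where "d = t - s" and "J = {0, d}"
    define B where "B = {x \<in> space (PiM J (\<lambda>_. borel)). x 0 \<in> S \<and> x d \<in> S}"
    have [measurable]: "(\<lambda>x. x 0) \<in> PiM J (\<lambda>_. borel) \<rightarrow>\<^sub>M borel" "(\<lambda>x. x d) \<in> PiM J (\<lambda>_. borel) \<rightarrow>\<^sub>M borel"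
      by (auto simp: J_def intro!: measurable_component_singleton)
    have "B \<in> sets (PiM J (\<lambda>_. borel))" unfolding B_def by measurable
    moreover have eq: "{\<omega> \<in> space M. (\<lambda>u\<in>J. X (u + k) \<omega>) \<in> B} = A k \<inter> A (d + k)" for k
      by (auto simp: A_def B_def J_def space_PiM)
    moreover have "finite J" by (simp add: J_def)
    ultimately have "prob (A s \<inter> A (d + s)) = prob (A 0 \<inter> A (d + 0))"
      using strictly_stationaryD[OF stat X, of J B s] eq[of s] eq[of 0] by (simp only: add_0_right)
    then show ?thesis by (simp add: d_def)
  qed
  have gen: "A t \<in> generated_events M X I" if "t \<in> I" for t I
    unfolding generated_events_def using that S
    by (intro sigma_sets.Basic UN_I[of t]) (auto simp: A_def)
  have cov1: "\<bar>prob (A s \<inter> A t) - q\<^sup>2\<bar> \<le> \<alpha> (nat (t - s))" if "s \<le> t" for s t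
  proof -
    have "\<bar>prob (A 0 \<inter> A (t - s)) - prob (A 0) * prob (A (t - s))\<bar> \<le> \<alpha> (nat (t - s))"
      unfolding \<alpha>_def using that by (intro alpha_coeff_ge X gen) auto
    then show ?thesis by (simp only: pA shift[of s t] power2_eq_square)
  qed
  have cov: "\<bar>prob (A s \<inter> A t) - q\<^sup>2\<bar> \<le> \<alpha> (nat \<bar>t - s\<bar>)" for s t
    using cov1[of s t] cov1[of t s] by (cases "s \<le> t") (auto simp: Int_commute)
  have \<alpha>_nonneg: "0 \<le> \<alpha> k" for k
    using cov1[of 0 "int k"] by simp
  define N where "N n \<omega> = (\<Sum>s=1..int n. indicator (A s) \<omega> :: real)" for n \<omega>
  define W where "W s \<omega> = (indicator (A s) \<omega> - q :: real)" for s \<omega>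
  have [measurable]: "W s \<in> borel_measurable M" "N n \<in> borel_measurable M" for s n
    unfolding W_def[abs_def] N_def[abs_def] by measurable
  have q1: "q \<le> 1" using q by simp
  have intW: "integrable M (\<lambda>\<omega>. W s \<omega> * W t \<omega>)" for s t
    using q1 q(2)
    by (intro integrable_const_bound[where B=1])
       (auto simp: W_def abs_mult intro!: mult_le_one split: split_indicator)
  have EW: "expectation (\<lambda>\<omega>. W s \<omega> * W t \<omega>) = prob (A s \<inter> A t) - q\<^sup>2" for s t
  proof -
    have "(\<lambda>\<omega>. W s \<omega> * W t \<omega>) = (\<lambda>\<omega>. indicator (A s \<inter> A t) \<omega> - q * indicator (A s) \<omega> - q * indicator (A t) \<omega> + q\<^sup>2)"
      by (auto simp: W_def fun_eq_iff power2_eq_square algebra_simps split: split_indicator)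
    moreover have "integrable M (\<lambda>\<omega>. indicator B \<omega> :: real)" if "B \<in> events" for B
      using that by (simp add: integrable_real_indicator emeasure_eq_measure)
    ultimately show ?thesis by (simp add: pA prob_space power2_eq_square)
  qed
  \<comment> \<open>Each distance \<open>k < n\<close> from \<open>s\<close> occurs at most once on
    either side, whence the factor 2. The blocks to the left and right of \<open>s\<close> share
    \<open>s\<close>, which is harmless as the coefficients are nonnegative.\<close>
  have row: "(\<Sum>t=1..int n. \<alpha> (nat \<bar>t - s\<bar>)) \<le> 2 * (\<Sum>k<n. \<alpha> k)" if s: "s \<in> {1..int n}" for s n
  proof -
    have "(\<Sum>t=1..int n. \<alpha> (nat \<bar>t - s\<bar>)) \<le> (\<Sum>t\<in>{1..s} \<union> {s..int n}. \<alpha> (nat \<bar>t - s\<bar>))"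
      using s \<alpha>_nonneg by (intro sum_mono2) auto
    also have "\<dots> \<le> (\<Sum>t=1..s. \<alpha> (nat \<bar>t - s\<bar>)) + (\<Sum>t=s..int n. \<alpha> (nat \<bar>t - s\<bar>))"
      using \<alpha>_nonneg by (subst sum_Un) (auto intro: sum_nonneg)
    also have "(\<Sum>t=1..s. \<alpha> (nat \<bar>t - s\<bar>)) \<le> (\<Sum>k<n. \<alpha> k)"
    proof (rule sum_le_included[where i="\<lambda>k. s - int k"])
      show "\<forall>t\<in>{1..s}. \<exists>k\<in>{..<n}. s - int k = t \<and> \<alpha> (nat \<bar>t - s\<bar>) \<le> \<alpha> k"
      proof
        fix t assume "t \<in> {1..s}"
        then show "\<exists>k\<in>{..<n}. s - int k = t \<and> \<alpha> (nat \<bar>t - s\<bar>) \<le> \<alpha> k"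
          using s by (intro bexI[of _ "nat \<bar>t - s\<bar>"]) auto
      qed
    qed (use \<alpha>_nonneg in auto)
    also have "(\<Sum>t=s..int n. \<alpha> (nat \<bar>t - s\<bar>)) \<le> (\<Sum>k<n. \<alpha> k)"
    proof (rule sum_le_included[where i="\<lambda>k. s + int k"])
      show "\<forall>t\<in>{s..int n}. \<exists>k\<in>{..<n}. s + int k = t \<and> \<alpha> (nat \<bar>t - s\<bar>) \<le> \<alpha> k"
      proof
        fix t assume "t \<in> {s..int n}"
        then show "\<exists>k\<in>{..<n}. s + int k = t \<and> \<alpha> (nat \<bar>t - s\<bar>) \<le> \<alpha> k"
          using s by (intro bexI[of _ "nat \<bar>t - s\<bar>"]) auto
      qed
    qed (use \<alpha>_nonneg in auto)
    finally show ?thesis by simp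
  qed
  have var: "expectation (\<lambda>\<omega>. (N n \<omega> - n * q)\<^sup>2) \<le> 2 * real n * (\<Sum>k<n. \<alpha> k)"
    and int: "integrable M (\<lambda>\<omega>. (N n \<omega> - n * q)\<^sup>2)" for n
  proof -
    have eq: "(N n \<omega> - n * q)\<^sup>2 = (\<Sum>s=1..int n. \<Sum>t=1..int n. W s \<omega> * W t \<omega>)" for \<omega>
      by (simp add: N_def W_def sum_subtractf power2_eq_square sum_product[symmetric])
    show "integrable M (\<lambda>\<omega>. (N n \<omega> - n * q)\<^sup>2)" unfolding eq using intW by simp
    have "expectation (\<lambda>\<omega>. (N n \<omega> - n * q)\<^sup>2) = (\<Sum>s=1..int n. \<Sum>t=1..int n. prob (A s \<inter> A t) - q\<^sup>2)"
      unfolding eq by (simp add: intW EW)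
    also have "\<dots> \<le> (\<Sum>s=1..int n. \<Sum>t=1..int n. \<alpha> (nat \<bar>t - s\<bar>))"
      by (intro sum_mono order.trans[OF abs_ge_self cov])
    also have "\<dots> \<le> (\<Sum>s=1..int n. 2 * (\<Sum>k<n. \<alpha> k))"
      by (intro sum_mono row)
    finally show "expectation (\<lambda>\<omega>. (N n \<omega> - n * q)\<^sup>2) \<le> 2 * real n * (\<Sum>k<n. \<alpha> k)" by simp
  qed
  have card: "real (card {s \<in> {1..int n}. X s \<omega> \<in> S}) = N n \<omega>" if "\<omega> \<in> space M" for n \<omega>
    using that by (simp add: N_def indicator_def A_def sum.If_cases Int_def)
  have bound: "prob {\<omega> \<in> space M. real (card {s \<in> {1..int n}. X s \<omega> \<in> S}) \<le> n * q / 2}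
    \<le> 8 / q\<^sup>2 * ((\<Sum>k<n. \<alpha> k) / n)" if "n > 0" for n
  proof -
    \<comment> \<open>A count at most half its mean \<open>n * q\<close> is off by at least
      \<open>n * q / 2\<close>.\<close>
    have "{\<omega> \<in> space M. real (card {s \<in> {1..int n}. X s \<omega> \<in> S}) \<le> n * q / 2}
      \<subseteq> {\<omega> \<in> space M. (N n \<omega> - n * q)\<^sup>2 \<ge> (n * q / 2)\<^sup>2}"
    proof (intro subsetI, elim CollectE conjE, intro CollectI conjI)
      fix \<omega> assume "\<omega> \<in> space M" "real (card {s \<in> {1..int n}. X s \<omega> \<in> S}) \<le> n * q / 2"
      then have "n * q / 2 \<le> \<bar>N n \<omega> - n * q\<bar>" "0 \<le> n * q / 2"
        using card[of \<omega> n] q(2) by (auto simp: mult.commute)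
      then show "(n * q / 2)\<^sup>2 \<le> (N n \<omega> - n * q)\<^sup>2"
        using power_mono[of "n * q / 2" "\<bar>N n \<omega> - n * q\<bar>" 2] by simp
    qed
    then have "prob {\<omega> \<in> space M. real (card {s \<in> {1..int n}. X s \<omega> \<in> S}) \<le> n * q / 2}
      \<le> prob {\<omega> \<in> space M. (N n \<omega> - n * q)\<^sup>2 \<ge> (n * q / 2)\<^sup>2}"
      by (intro finite_measure_mono) auto
    also have "\<dots> \<le> expectation (\<lambda>\<omega>. (N n \<omega> - n * q)\<^sup>2) / (n * q / 2)\<^sup>2"
      using that q(2) by (intro integral_Markov_inequality_measure[where A="{}"] int) auto
    also have "\<dots> \<le> 2 * real n * (\<Sum>k<n. \<alpha> k) / (n * q / 2)\<^sup>2"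
      by (intro divide_right_mono var) auto
    also have "\<dots> = 8 / q\<^sup>2 * ((\<Sum>k<n. \<alpha> k) / n)"
      using that q(2) by (simp add: field_simps power2_eq_square)
    finally show ?thesis .
  qed
  have "(\<lambda>n. (\<Sum>k<n. \<alpha> k) / real n) \<longlonglongrightarrow> 0"
    using mix by (intro cesaro_mean_tendsto_0) (simp add: alpha_mixing_def \<alpha>_def)
  from tendsto_mult_right_zero[OF this, of "8 / q\<^sup>2"]
  show ?thesis
  proof (rule tendsto_sandwich[OF _ _ tendsto_const, rotated 2])
    show "\<forall>\<^sub>F n in sequentially. prob {\<omega> \<in> space M. real (card {s \<in> {1..int n}. X s \<omega> \<in> S}) \<le> real n * q / 2}
      \<le> 8 / q\<^sup>2 * ((\<Sum>k<n. \<alpha> k) / real n)"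
      using eventually_gt_at_top[of 0] by eventually_elim (rule bound)
  qed simp
qed

section \<open>Support points, Tonelli and nondegeneracy\<close>

text \<open>Almost surely \<open>X\<close> avoids all of the countably many rational intervals of
  probability 0, and every ball around \<open>X \<omega>\<close> contains a rational interval around
  \<open>X \<omega>\<close>.\<close>

lemma (in prob_space) AE_in_support:
  fixes X :: "'a \<Rightarrow> real"
  assumes [measurable]: "X \<in> borel_measurable M"
  shows "AE \<omega> in M. \<forall>r>0. 0 < prob {\<omega>' \<in> space M. X \<omega>' \<in> cball (X \<omega>) r}"
proof -
  have "AE \<omega> in M. \<forall>a\<in>\<rat>. \<forall>b\<in>\<rat>. X \<omega> \<in> {a<..<b} \<longrightarrow> 0 < prob {\<omega>' \<in> space M. X \<omega>' \<in> {a<..<b}}"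
  proof (intro AE_ball_countable[THEN iffD2] countable_rat ballI)
    fix a b :: real
    show "AE \<omega> in M. X \<omega> \<in> {a<..<b} \<longrightarrow> 0 < prob {\<omega>' \<in> space M. X \<omega>' \<in> {a<..<b}}"
    proof (cases "prob {\<omega>' \<in> space M. X \<omega>' \<in> {a<..<b}} = 0")
      case True
      then have "{\<omega>' \<in> space M. X \<omega>' \<in> {a<..<b}} \<in> null_sets M"
        by (auto simp: null_sets_def emeasure_eq_measure)
      then have "AE \<omega> in M. \<omega> \<notin> {\<omega>' \<in> space M. X \<omega>' \<in> {a<..<b}}" by (rule AE_not_in)
      then show ?thesis by (rule AE_mp) (auto intro!: AE_I2)
    next
      case False
      then show ?thesis by (simp add: zero_less_measure_iff)
    qed
  qed
  then show ?thesis
  proof (rule AE_mp, intro AE_I2 impI allI)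
    fix \<omega> and r :: real
    assume *: "\<forall>a\<in>\<rat>. \<forall>b\<in>\<rat>. X \<omega> \<in> {a<..<b} \<longrightarrow> 0 < prob {\<omega>' \<in> space M. X \<omega>' \<in> {a<..<b}}" and "0 < r"
    obtain a where a: "a \<in> \<rat>" "X \<omega> - r < a" "a < X \<omega>"
      using Rats_dense_in_real[of "X \<omega> - r" "X \<omega>"] \<open>0 < r\<close> by auto
    obtain b where b: "b \<in> \<rat>" "X \<omega> < b" "b < X \<omega> + r"
      using Rats_dense_in_real[of "X \<omega>" "X \<omega> + r"] \<open>0 < r\<close> by auto
    have "0 < prob {\<omega>' \<in> space M. X \<omega>' \<in> {a<..<b}}" using * a b by auto
    also have "\<dots> \<le> prob {\<omega>' \<in> space M. X \<omega>' \<in> cball (X \<omega>) r}"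
      using a b by (intro finite_measure_mono) (auto simp: dist_real_def)
    finally show "0 < prob {\<omega>' \<in> space M. X \<omega>' \<in> cball (X \<omega>) r}" .
  qed
qed

text \<open>Tonelli for the product law: the outer point \<omega>' acts as an independent copy, so
  \<open>U\<close> can be frozen while \<open>V\<close> is averaged.\<close>

lemma (in prob_space) nn_integral_indep_var:
  assumes indep: "indep_var S V T U" and f[measurable]: "f \<in> borel_measurable (S \<Otimes>\<^sub>M T)"
  shows "(\<integral>\<^sup>+ \<omega>. f (V \<omega>, U \<omega>) \<partial>M) = (\<integral>\<^sup>+ \<omega>'. \<integral>\<^sup>+ \<omega>. f (V \<omega>, U \<omega>') \<partial>M \<partial>M)"
proof -
  have [measurable]: "V \<in> M \<rightarrow>\<^sub>M S" "U \<in> M \<rightarrow>\<^sub>M T"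
    using indep by (blast dest: indep_var_rv1 indep_var_rv2)+
  interpret V: prob_space "distr M S V" by (rule prob_space_distr) simp
  interpret U: prob_space "distr M T U" by (rule prob_space_distr) simp
  interpret VU: pair_sigma_finite "distr M S V" "distr M T U" ..
  have "(\<integral>\<^sup>+ \<omega>. f (V \<omega>, U \<omega>) \<partial>M) = integral\<^sup>N (distr M (S \<Otimes>\<^sub>M T) (\<lambda>\<omega>. (V \<omega>, U \<omega>))) f"
    by (simp add: nn_integral_distr)
  also have "\<dots> = integral\<^sup>N (distr M S V \<Otimes>\<^sub>M distr M T U) f"
    using indep by (simp add: indep_var_distribution_eq)
  also have "\<dots> = (\<integral>\<^sup>+ y. \<integral>\<^sup>+ x. f (x, y) \<partial>distr M S V \<partial>distr M T U)"
    by (rule VU.nn_integral_snd[symmetric]) (simp cong: measurable_cong_sets)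
  also have "\<dots> = (\<integral>\<^sup>+ y. \<integral>\<^sup>+ \<omega>. f (V \<omega>, y) \<partial>M \<partial>distr M T U)"
    by (intro nn_integral_cong nn_integral_distr) auto
  also have "\<dots> = (\<integral>\<^sup>+ \<omega>'. \<integral>\<^sup>+ \<omega>. f (V \<omega>, U \<omega>') \<partial>M \<partial>M)"
    by (intro nn_integral_distr) auto
  finally show ?thesis .
qed

text \<open>The strict upper bound is what yields a positive exponential rate later:
  \<open>1 - exp (- D \<omega>)\<close> is nonnegative and vanishes only where \<open>D\<close>
  does, and \<open>D\<close> is not almost surely zero.\<close>

lemma (in prob_space) expectation_exp_minus:
  assumes [measurable]: "D \<in> borel_measurable M" and nn: "\<And>\<omega>. 0 \<le> D \<omega>"
    and pos: "0 < (\<integral>\<^sup>+ \<omega>. ennreal (D \<omega>) \<partial>M)"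
  shows "0 < expectation (\<lambda>\<omega>. exp (- D \<omega>))" "expectation (\<lambda>\<omega>. exp (- D \<omega>)) < 1"
proof -
  have int: "integrable M (\<lambda>\<omega>. exp (- D \<omega>))"
    using nn by (intro integrable_const_bound[where B=1]) auto
  have "expectation (\<lambda>\<omega>. exp (- D \<omega>)) \<noteq> 0"
    using integral_nonneg_eq_0_iff_AE[OF int] AE_False by auto
  moreover have "0 \<le> expectation (\<lambda>\<omega>. exp (- D \<omega>))" by simp
  ultimately show "0 < expectation (\<lambda>\<omega>. exp (- D \<omega>))" by linarith
  have int': "integrable M (\<lambda>\<omega>. 1 - exp (- D \<omega>))" using int by simp
  have "expectation (\<lambda>\<omega>. 1 - exp (- D \<omega>)) \<noteq> 0"
  proof
    assume "expectation (\<lambda>\<omega>. 1 - exp (- D \<omega>)) = 0"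
    then have "AE \<omega> in M. 1 - exp (- D \<omega>) = 0"
      using integral_nonneg_eq_0_iff_AE[OF int'] nn by simp
    then have "AE \<omega> in M. ennreal (D \<omega>) = 0" by (rule AE_mp) (auto intro!: AE_I2)
    then have "(\<integral>\<^sup>+ \<omega>. ennreal (D \<omega>) \<partial>M) = 0"
      by (subst nn_integral_0_iff_AE) auto
    then show False using pos by simp
  qed
  moreover have "0 \<le> expectation (\<lambda>\<omega>. 1 - exp (- D \<omega>))"
    using nn by (intro integral_nonneg_AE) auto
  ultimately show "expectation (\<lambda>\<omega>. exp (- D \<omega>)) < 1"
    using int by (simp add: prob_space)
qed

section \<open>Linear growth of the variation near one support point\<close>

theorem theorem8p3:
  fixes M :: "'a measure"
    and X \<delta> Y :: "int \<Rightarrow> 'a \<Rightarrow> real"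
    and F h\<^sub>0 :: "real \<Rightarrow> real"
    and p :: real
  assumes "prob_space M"
    and "\<And>t. X t \<in> borel_measurable M"
    and "\<And>t. \<delta> t \<in> borel_measurable M"
    and "\<And>t. cdf (distr M borel (X t)) = F" and "continuous_on UNIV F"
    and "AE \<omega> in M. \<forall>s t. s \<noteq> t \<longrightarrow> X s \<omega> \<noteq> X t \<omega>"
    and "\<And>t \<omega>. \<omega> \<in> space M \<Longrightarrow> Y t \<omega> = h\<^sub>0 (X t \<omega> + \<delta> t \<omega>)"
    and "\<exists>L. L-lipschitz_on UNIV h\<^sub>0"
    and "strictly_stationary M X"
    and "alpha_mixing M X"
    and "p > 1"
    and "\<And>t. integrable M (\<lambda>\<omega>. \<bar>X t \<omega>\<bar> powr p)"
    and "prob_space.indep_vars M (\<lambda>_. borel) \<delta> UNIV"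
    and "\<And>s t. distr M borel (\<delta> s) = distr M borel (\<delta> t)"
    and "prob_space.indep_var M
           (PiM UNIV (\<lambda>_. borel)) (\<lambda>\<omega> t. \<delta> t \<omega>)
           (PiM UNIV (\<lambda>_. borel)) (\<lambda>\<omega> t. X t \<omega>)"
    and "(\<integral>\<^sup>+ \<omega>. ennreal \<bar>h\<^sub>0 (X 1 \<omega> + \<delta> 2 \<omega>) - h\<^sub>0 (X 1 \<omega> + \<delta> 1 \<omega>)\<bar> \<partial>M) > 0"
  shows "out_of_reasonable_order M X Y p"
proof -
  interpret prob_space M by fact
  note X[measurable] = assms(2) and \<delta>[measurable] = assms(3)
    and indep = assms(15)
  obtain L where L: "L-lipschitz_on UNIV h\<^sub>0" using assms(8) by blast
  have L0: "0 \<le> L" and lip: "\<bar>h\<^sub>0 x - h\<^sub>0 y\<bar> \<le> L * \<bar>x - y\<bar>" for x y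
    using L by (auto simp: lipschitz_on_def dist_real_def)
  have h[measurable]: "h\<^sub>0 \<in> borel_measurable borel"
    using lipschitz_on_continuous_on[OF L] by (rule borel_measurable_continuous_onI)
  obtain x\<^sub>0 where supp: "\<And>r. 0 < r \<Longrightarrow> 0 < prob {\<omega> \<in> space M. X 1 \<omega> \<in> cball x\<^sub>0 r}"
    and x0: "0 < (\<integral>\<^sup>+ \<omega>. ennreal \<bar>h\<^sub>0 (x\<^sub>0 + \<delta> 2 \<omega>) - h\<^sub>0 (x\<^sub>0 + \<delta> 1 \<omega>)\<bar> \<partial>M)"
  proof -
    let ?g = "\<lambda>x. \<integral>\<^sup>+ \<omega>. ennreal \<bar>h\<^sub>0 (x + \<delta> 2 \<omega>) - h\<^sub>0 (x + \<delta> 1 \<omega>)\<bar> \<partial>M"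
    have "(\<lambda>(d, x). ennreal \<bar>h\<^sub>0 (x 1 + d 2) - h\<^sub>0 (x 1 + d 1)\<bar>) \<in> borel_measurable
      (PiM UNIV (\<lambda>_::int. borel) \<Otimes>\<^sub>M PiM UNIV (\<lambda>_::int. borel))"
      by measurable
    \<comment> \<open>Freezing the inputs turns condition (ii) into positivity of the mean of
      \<open>?g (X 1 \<omega>)\<close>. Since almost every value of \<open>X 1\<close> lies in the
      support, some value satisfies both demands on \<open>x\<^sub>0\<close>.\<close>
    from nn_integral_indep_var[OF indep this]
    have "0 < (\<integral>\<^sup>+ \<omega>. ?g (X 1 \<omega>) \<partial>M)" using assms(16) by simp
    then have "\<not> (AE \<omega> in M. ?g (X 1 \<omega>) = 0)"
      using nn_integral_cong_AE[of "\<lambda>\<omega>. ?g (X 1 \<omega>)" "\<lambda>_. 0" M] by auto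
    then have "\<not> (AE \<omega> in M. (\<forall>r>0. 0 < prob {\<omega>' \<in> space M. X 1 \<omega>' \<in> cball (X 1 \<omega>) r}) \<longrightarrow> ?g (X 1 \<omega>) = 0)"
      using AE_mp[OF AE_in_support[OF X[of 1]], of "\<lambda>\<omega>. ?g (X 1 \<omega>) = 0"] by blast
    then have "\<exists>\<omega>. ?g (X 1 \<omega>) \<noteq> 0 \<and> (\<forall>r>0. 0 < prob {\<omega>' \<in> space M. X 1 \<omega>' \<in> cball (X 1 \<omega>) r})"
    proof (rule contrapos_np)
      assume "\<nexists>\<omega>. ?g (X 1 \<omega>) \<noteq> 0 \<and> (\<forall>r>0. 0 < prob {\<omega>' \<in> space M. X 1 \<omega>' \<in> cball (X 1 \<omega>) r})"
      then show "AE \<omega> in M. (\<forall>r>0. 0 < prob {\<omega>' \<in> space M. X 1 \<omega>' \<in> cball (X 1 \<omega>) r}) \<longrightarrow> ?g (X 1 \<omega>) = 0"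
        by (intro AE_I2) blast
    qed
    then obtain \<omega> where "?g (X 1 \<omega>) \<noteq> 0"
      "\<forall>r>0. 0 < prob {\<omega>' \<in> space M. X 1 \<omega>' \<in> cball (X 1 \<omega>) r}"
      by (elim exE conjE)
    then show ?thesis using that[of "X 1 \<omega>"] by (simp add: zero_less_iff_neq_zero)
  qed
  define Z where "Z s \<omega> = h\<^sub>0 (x\<^sub>0 + \<delta> s \<omega>)" for s \<omega>
  have indepZ: "indep_vars (\<lambda>_. borel) Z UNIV"
    unfolding Z_def[abs_def] using assms(13) by (rule indep_vars_compose2) measurable
  have distrZ: "distr M borel (Z s) = distr M borel (Z t)" for s t
  proof -
    have "distr M borel (Z s) = distr (distr M borel (\<delta> s)) borel (\<lambda>d. h\<^sub>0 (x\<^sub>0 + d))" for s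
      by (subst distr_distr) (auto simp: comp_def Z_def[abs_def])
    then show ?thesis using assms(14)[of s t] by simp
  qed
  \<comment> \<open>Chosen so that the exponential moment of one pair equals
    \<open>exp (- 2 * \<kappa>)\<close>; positive because that moment lies strictly between 0 and
    1.\<close>
  define \<kappa> where "\<kappa> = - ln (expectation (\<lambda>\<omega>. exp (- \<bar>Z 2 \<omega> - Z 1 \<omega>\<bar>))) / 2"
  have \<rho>: "0 < expectation (\<lambda>\<omega>. exp (- \<bar>Z 2 \<omega> - Z 1 \<omega>\<bar>))" "expectation (\<lambda>\<omega>. exp (- \<bar>Z 2 \<omega> - Z 1 \<omega>\<bar>)) < 1"
    using x0 by (intro expectation_exp_minus; simp add: Z_def)+
  then have \<kappa>: "0 < \<kappa>" "expectation (\<lambda>\<omega>. exp (- \<bar>Z 2 \<omega> - Z 1 \<omega>\<bar>)) = exp (- 2 * \<kappa>)"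
    by (auto simp: \<kappa>_def)
  \<comment> \<open>Replacing \<open>Z\<close> by \<open>Y\<close> costs at most
    \<open>2 * (L * r)\<close> per pair; this radius keeps that below half of the gain \<kappa>.
    Using \<open>L + 1\<close> covers \<open>L = 0\<close>.\<close>
  define r where "r = \<kappa> / (4 * (L + 1))"
  have r: "0 < r" "2 * (L * r) \<le> \<kappa> / 2"
    using \<kappa>(1) L0 by (auto simp: r_def field_simps)
  \<comment> \<open>Taken at time 0 to fit the lemma on visits; stationarity carries positivity over
    from time 1.\<close>
  define q where "q = prob {\<omega> \<in> space M. X 0 \<omega> \<in> cball x\<^sub>0 r}"
  have q: "0 < q"
    using supp[OF r(1)] strictly_stationary_marginal[OF assms(9) X, of "cball x\<^sub>0 r" 1] by (simp add: q_def)
  \<comment> \<open>A function on path space, so that the retained sorted list is visibly determined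
    by the inputs alone and therefore independent of the anomalies.\<close>
  define R where "R n x = filter (\<lambda>s. x s \<in> cball x\<^sub>0 r) (sort_key x [1..int n])"
    for n and x :: "int \<Rightarrow> real"
  have R[measurable]: "R n \<in> PiM UNIV (\<lambda>_. borel) \<rightarrow>\<^sub>M count_space UNIV" for n
  proof -
    have comp: "(\<lambda>x. x s) \<in> borel_measurable (PiM UNIV (\<lambda>_. borel :: real measure))" for s :: int
      by (rule measurable_component_singleton) simp
    have "Measurable.pred (PiM UNIV (\<lambda>_. borel)) (\<lambda>x. x s \<in> cball x\<^sub>0 r)" for s :: int
      by (rule pred_sets1[OF _ comp]) simp
    then show ?thesis
      unfolding R_def[abs_def] by (rule measurable_filter[OF _ measurable_sort_key[OF comp]])
  qed
  have length_R: "length (R n x) = card {s \<in> {1..int n}. x s \<in> cball x\<^sub>0 r}" for n x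
  proof -
    have "distinct (R n x)" by (simp add: R_def)
    then have "length (R n x) = card (set (R n x))" by (rule distinct_card[symmetric])
    also have "set (R n x) = {s \<in> {1..int n}. x s \<in> cball x\<^sub>0 r}" by (auto simp: R_def)
    finally show ?thesis .
  qed
  \<comment> \<open>The finitely many lists that can occur as \<open>R n\<close> with enough
    entries. For each, \<open>G l\<close> constrains only the anomalies and \<open>A n l\<close>
    only the inputs.\<close>
  define I where "I n = {l. set l \<subseteq> {1..int n} \<and> length l \<le> n \<and> distinct l \<and> n * q / 2 < length l}" for n :: nat
  define G where "G l = {d \<in> space (PiM UNIV (\<lambda>_. borel)).
    pair_var (\<lambda>s. h\<^sub>0 (x\<^sub>0 + d s)) l \<le> \<kappa> * real (length l div 2)}" for l :: "int list"
  define A where "A n l = {x \<in> space (PiM UNIV (\<lambda>_. borel)). R n x = l}" for n l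
  define Bad where "Bad n = (\<Union>l\<in>I n. ((\<lambda>\<omega> t. \<delta> t \<omega>) -` G l \<inter> space M) \<inter> ((\<lambda>\<omega> t. X t \<omega>) -` A n l \<inter> space M))" for n
  define Low where "Low n = {\<omega> \<in> space M. real (card {s \<in> {1..int n}. X s \<omega> \<in> cball x\<^sub>0 r}) \<le> real n * q / 2}" for n
  \<comment> \<open>Rounding in \<open>div 2\<close> loses at most 1/2, so subtracting 1 is
    safe.\<close>
  have half: "n * q / 4 - 1 \<le> real (k div 2)" if "n * q / 2 < real k" for n k :: nat
    using that by linarith
  have Gm: "G l \<in> sets (PiM UNIV (\<lambda>_. borel))" for l
  proof -
    have [measurable]: "(\<lambda>d. pair_var (\<lambda>s. h\<^sub>0 (x\<^sub>0 + d s)) l) \<in> borel_measurable (PiM UNIV (\<lambda>_. borel))"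
      by (rule borel_measurable_pair_var) measurable
    show ?thesis unfolding G_def by measurable
  qed
  have Am: "A n l \<in> sets (PiM UNIV (\<lambda>_. borel))" for n l
    unfolding A_def by measurable
  have finI: "finite (I n)" for n
    by (rule finite_subset[OF _ finite_lists_length_le[of "{1..int n}" n]]) (auto simp: I_def)
  have Bad_meas: "Bad n \<in> events" for n
    unfolding Bad_def
    using measurable_sets[OF indep_var_rv1[OF indep] Gm] measurable_sets[OF indep_var_rv2[OF indep] Am] finI
    by auto
  have Low_meas: "Low n \<in> events" for n
  proof -
    note [measurable] = indep_var_rv2[OF indep]
    show ?thesis unfolding Low_def length_R[symmetric] by measurable
  qed
  have prob_Bad: "prob (Bad n) \<le> exp (- \<kappa> * (n * q / 4 - 1))" for n
    unfolding Bad_def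
  proof (rule prob_Union_le_of_indep[OF indep finI Am _ Gm])
    show "disjoint_family_on (A n) (I n)" by (auto simp: A_def disjoint_family_on_def)
    fix l assume l: "l \<in> I n"
    have "(\<lambda>\<omega> t. \<delta> t \<omega>) -` G l \<inter> space M = {\<omega> \<in> space M. pair_var (\<lambda>s. Z s \<omega>) l \<le> \<kappa> * real (length l div 2)}"
      by (auto simp: G_def Z_def space_PiM)
    also have "prob \<dots> \<le> exp (- \<kappa> * real (length l div 2))"
      using l by (intro prob_pair_var_le[OF indepZ distrZ _ _ \<kappa>(2)]) (auto simp: I_def)
    also have "\<dots> \<le> exp (- \<kappa> * (n * q / 4 - 1))"
      using half[of n "length l"] l \<kappa>(1) by (auto simp: I_def)
    finally show "prob ((\<lambda>\<omega> t. \<delta> t \<omega>) -` G l \<inter> space M) \<le> exp (- \<kappa> * (n * q / 4 - 1))" .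
  qed simp
  obtain N\<^sub>0 where N0: "N\<^sub>0 \<in> null_sets M"
    and distinct_X: "\<And>\<omega>. \<omega> \<in> space M - N\<^sub>0 \<Longrightarrow> \<forall>s t. s \<noteq> t \<longrightarrow> X s \<omega> \<noteq> X t \<omega>"
    using AE_E3[OF assms(6)] by blast
  \<comment> \<open>Off \<open>Low n\<close> there are at least \<open>n * q / 4 - 1\<close> pairs;
    off \<open>Bad n\<close> the variation of \<open>Z\<close> exceeds \<kappa> per pair, of which
    the perturbation leaves at least \<open>\<kappa> / 2\<close>. Off \<open>N\<^sub>0\<close> there
    are no ties, so \<open>B_stat\<close> is the variation along the sorted list.\<close>
  have B_ge: "n powr (- 1 / p) * (\<kappa> / 2 * (n * q / 4 - 1)) \<le> B_stat X Y p n \<omega>"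
    if \<omega>: "\<omega> \<in> space M" "\<omega> \<notin> N\<^sub>0" "\<omega> \<notin> Low n" "\<omega> \<notin> Bad n" for n \<omega>
  proof -
    define l where "l = R n (\<lambda>s. X s \<omega>)"
    have len: "n * q / 2 < length l"
      using \<omega> by (simp add: l_def length_R Low_def)
    have set_l: "set l \<subseteq> {1..int n}" by (auto simp: l_def R_def)
    have "distinct l" by (simp add: l_def R_def)
    then have "length l \<le> n" using card_mono[OF _ set_l] by (simp add: distinct_card)
    then have "l \<in> I n" using len set_l \<open>distinct l\<close> by (simp add: I_def)
    then have Z_l: "\<kappa> * real (length l div 2) < pair_var (\<lambda>s. Z s \<omega>) l"
      using \<omega> by (auto simp: Bad_def A_def G_def space_PiM l_def Z_def not_le)
    have "\<bar>Y s \<omega> - Z s \<omega>\<bar> \<le> L * r" if "s \<in> set l" for s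
    proof -
      have "\<bar>Y s \<omega> - Z s \<omega>\<bar> \<le> L * \<bar>X s \<omega> - x\<^sub>0\<bar>"
        using lip[of "X s \<omega> + \<delta> s \<omega>" "x\<^sub>0 + \<delta> s \<omega>"] \<omega>(1) by (simp add: Z_def assms(7))
      also have "\<dots> \<le> L * r"
        using that L0 by (intro mult_left_mono) (auto simp: l_def R_def dist_real_def)
      finally show ?thesis .
    qed
    then have "pair_var (\<lambda>s. Z s \<omega>) l - 2 * (L * r) * real (length l div 2) \<le> pair_var (\<lambda>s. Y s \<omega>) l"
      by (rule pair_var_perturb)
    moreover have "2 * (L * r) * real (length l div 2) \<le> \<kappa> / 2 * real (length l div 2)"
      using r(2) by (rule mult_right_mono) simp
    moreover have "\<kappa> / 2 * (n * q / 4 - 1) \<le> \<kappa> / 2 * real (length l div 2)"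
      using \<kappa>(1) half[OF len] by (intro mult_left_mono) auto
    ultimately have "\<kappa> / 2 * (n * q / 4 - 1) \<le> pair_var (\<lambda>s. Y s \<omega>) l"
      using Z_l by linarith
    also have "\<dots> \<le> list_var (\<lambda>s. Y s \<omega>) l" by (rule pair_var_le_list_var)
    also have "\<dots> \<le> list_var (\<lambda>s. Y s \<omega>) (sort_key (\<lambda>s. X s \<omega>) [1..int n])"
      unfolding l_def R_def by (rule list_var_filter_le)
    finally have "n powr (- 1 / p) * (\<kappa> / 2 * (n * q / 4 - 1))
      \<le> n powr (- 1 / p) * list_var (\<lambda>s. Y s \<omega>) (sort_key (\<lambda>s. X s \<omega>) [1..int n])"
      by (intro mult_left_mono) auto
    then show ?thesis
      using distinct_X[of \<omega>] \<omega> by (subst B_stat_eq_list_var) (auto simp: inj_on_def)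
  qed
  show ?thesis
    unfolding out_of_reasonable_order_def
  proof
    fix c :: real
    \<comment> \<open>The lower bound on \<open>B_stat\<close> grows like n to the power
      \<open>1 - 1 / p\<close>, a positive exponent.\<close>
    have "- 1 / p > -1" using assms(11) by (simp add: field_simps)
    then have "filterlim (\<lambda>n. real n powr (- 1 / p) * (\<kappa> / 2 * (real n * q / 4 - 1))) at_top sequentially"
      using \<kappa>(1) q by real_asymp
    then have large: "\<forall>\<^sub>F n in sequentially. real n powr (- 1 / p) * (\<kappa> / 2 * (real n * q / 4 - 1)) > c"
      by (simp add: filterlim_at_top_dense)
    have le: "\<forall>\<^sub>F n in sequentially. prob {\<omega> \<in> space M. B_stat X Y p n \<omega> \<le> c}
      \<le> prob (Low n) + exp (- \<kappa> * (n * q / 4 - 1))"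
      using large
    proof eventually_elim
      case (elim n)
      \<comment> \<open>Monotonicity of the measure asks for measurability of the covering union
        only.\<close>
      have "{\<omega> \<in> space M. B_stat X Y p n \<omega> \<le> c} \<subseteq> Low n \<union> Bad n \<union> N\<^sub>0"
        using elim B_ge[of _ n] by fastforce
      then have "prob {\<omega> \<in> space M. B_stat X Y p n \<omega> \<le> c} \<le> prob (Low n \<union> Bad n \<union> N\<^sub>0)"
        using Low_meas Bad_meas N0 by (intro finite_measure_mono) auto
      also have "\<dots> = prob (Low n \<union> Bad n)"
        using Low_meas Bad_meas N0 by (intro measure_Un_null_set) auto
      also have "\<dots> \<le> prob (Low n) + prob (Bad n)"
        using Low_meas Bad_meas by (intro measure_Un_le) auto
      finally show ?case using prob_Bad[of n] by simp
    qed
    have "(\<lambda>n. prob (Low n)) \<longlonglongrightarrow> 0"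
      unfolding Low_def
      by (rule mixing_hits_lower_tail[OF X assms(9,10) _ q_def q]) simp
    moreover have "(\<lambda>n. exp (- \<kappa> * (real n * q / 4 - 1))) \<longlonglongrightarrow> 0"
      using \<kappa>(1) q by real_asymp
    ultimately have "(\<lambda>n. prob (Low n) + exp (- \<kappa> * (real n * q / 4 - 1))) \<longlonglongrightarrow> 0 + 0"
      by (rule tendsto_add)
    then show "(\<lambda>n. prob {\<omega> \<in> space M. B_stat X Y p n \<omega> \<le> c}) \<longlonglongrightarrow> 0"
      by (intro tendsto_sandwich[OF _ le tendsto_const]) auto
  qed
qed

end
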